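(* For all nonnegative integers $m,n$, every eigenvalue of the adjacency matrix of the simplicial rook graph ${\rm SR}(m,n)$ is an integer.
   Context: Let $\mathbb{N}=\{0,1,2,\dots\}$. For $m,n\in\mathbb{N}$, the simplicial rook graph ${\rm SR}(m,n)$ has as vertices the vectors in $\mathbb{N}^m$ with coordinate sum $n$; two vertices are adjacent when they differ in precisely two coordinate positions. Eigenvalues of a graph are those of its adjacency matrix. *)

theory Defs
  imports "Jordan_Normal_Form.Char_Poly"
begin

definition SR_vertices :: "nat \<Rightarrow> nat \<Rightarrow> nat list set" where
  "SR_vertices m n = {x. length x = m \<and> sum_list x = n}"

definition SR_adj :: "nat \<Rightarrow> nat list \<Rightarrow> nat list \<Rightarrow> bool" where
  "SR_adj m x y = (card {i. i < m \<and> x ! i \<noteq> y ! i} = 2)"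

text \<open>Adjacency matrix of SR(m,n) with respect to an enumeration vs of its vertex set.\<close>
definition SR_adj_mat :: "nat \<Rightarrow> nat list list \<Rightarrow> complex mat" where
  "SR_adj_mat m vs = mat (length vs) (length vs)
     (\<lambda>(i, j). if SR_adj m (vs ! i) (vs ! j) then 1 else 0)"

end

theory Submission
  imports Defs
begin

text \<open>
  Write the adjacency operator as the sum over all pairs \<open>i < j\<close> of \<open>B\<^sub>i\<^sub>j - 1\<close>, where \<open>B\<^sub>i\<^sub>j\<close> sums a
  function over the line through a vertex in direction \<open>e\<^sub>i - e\<^sub>j\<close>. A map \<open>\<phi>\<close> on the coordinates
  distributes them into blocks and splits the vertex set into classes with prescribed block sums.
  Given an eigenfunction \<open>f\<close>, choose \<open>\<phi>\<close> and a class \<open>C\<close>, containing \<open>a\<close> say, on which \<open>f\<close> has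
  nonzero sum, such that the weight \<open>\<Sum>i. \<phi> i * (2 * a\<^sub>i + 1)\<close> (which depends only on \<open>\<phi>\<close> and \<open>C\<close>) is
  minimal. Now sum \<open>B\<^sub>i\<^sub>j f\<close> over \<open>C\<close>. If \<open>i\<close> and \<open>j\<close> lie in different blocks \<open>p < q\<close>, the result is
  the sum of \<open>f\<close> over a union of classes for \<open>\<phi>(j := p)\<close> minus the sum over a union of classes for
  \<open>\<phi>(i := q)\<close>, all of smaller weight, so it vanishes. If they lie in the same block, \<open>f v\<close> is
  counted \<open>v\<^sub>i + v\<^sub>j + 1\<close> times for each \<open>v\<close> in \<open>C\<close>; added up over all such pairs this is a number
  depending only on the block sums. Hence the eigenvalue is this number minus \<open>m choose 2\<close>.
\<close>

definition block_sum :: "nat \<Rightarrow> (nat \<Rightarrow> nat) \<Rightarrow> nat list \<Rightarrow> nat \<Rightarrow> nat" where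
  "block_sum m \<phi> a p = (\<Sum>i<m. if \<phi> i = p then a ! i else 0)"

definition block_class :: "nat \<Rightarrow> nat \<Rightarrow> (nat \<Rightarrow> nat) \<Rightarrow> nat list \<Rightarrow> nat list set" where
  "block_class m n \<phi> a = {b \<in> SR_vertices m n. block_sum m \<phi> b = block_sum m \<phi> a}"

text \<open>The truncated line through \<open>u\<close>: the entries are naturals, so it stops at
  the boundary of the simplex. It contains \<open>u\<close> itself when \<open>u\<close> has length
  \<open>m\<close>, which is why \<open>f u\<close> is subtracted from line sums later on.\<close>

definition line :: "nat \<Rightarrow> nat \<Rightarrow> nat \<Rightarrow> nat list \<Rightarrow> nat list set" where
  "line m i j u = {v. length v = m \<and> v ! i + v ! j = u ! i + u ! j \<and>
     (\<forall>k<m. k \<noteq> i \<longrightarrow> k \<noteq> j \<longrightarrow> v ! k = u ! k)}"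

definition pairs :: "nat \<Rightarrow> (nat \<times> nat) set" where
  "pairs m = {(i, j). i < j \<and> j < m}"

text \<open>The factor 2 lets the gain from moving one unit of \<open>a\<close> to a lower block outweigh the loss
  from moving one coordinate between the same blocks in the opposite direction.\<close>

definition weight :: "nat \<Rightarrow> (nat \<Rightarrow> nat) \<Rightarrow> nat list \<Rightarrow> nat" where
  "weight m \<phi> a = (\<Sum>i<m. \<phi> i * (2 * a ! i + 1))"

section \<open>Lines in the vertex set\<close>

lemma finite_SR_vertices: "finite (SR_vertices m n)"
proof (rule finite_subset)
  show "SR_vertices m n \<subseteq> {xs. set xs \<subseteq> {..n} \<and> length xs = m}"
    using member_le_sum_list by (fastforce simp: SR_vertices_def)
qed (simp add: finite_lists_length_eq)

lemma finite_pairs: "finite (pairs m)"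
  by (rule finite_subset[of _ "{..<m} \<times> {..<m}"]) (auto simp: pairs_def)

lemma sum_remove_two:
  fixes g :: "nat \<Rightarrow> 'a::comm_monoid_add"
  assumes "i < m" "j < m" "i \<noteq> j"
  shows "(\<Sum>k<m. g k) = g i + (g j + (\<Sum>k\<in>{..<m} - {i} - {j}. g k))"
proof -
  have "(\<Sum>k<m. g k) = g i + (\<Sum>k\<in>{..<m} - {i}. g k)"
    by (rule sum.remove) (use assms in auto)
  also have "(\<Sum>k\<in>{..<m} - {i}. g k) = g j + (\<Sum>k\<in>{..<m} - {i} - {j}. g k)"
    by (rule sum.remove) (use assms in auto)
  finally show ?thesis .
qed

lemma line_sym: "length u = m \<Longrightarrow> length v = m \<Longrightarrow> v \<in> line m i j u \<longleftrightarrow> u \<in> line m i j v"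
  by (auto simp: line_def)

lemma line_commute: "line m i j u = line m j i u"
  by (auto simp: line_def)

lemma line_subset_SR_vertices:
  assumes "u \<in> SR_vertices m n" "i < m" "j < m" "i \<noteq> j"
  shows "line m i j u \<subseteq> SR_vertices m n"
proof
  fix v assume v: "v \<in> line m i j u"
  have "(\<Sum>k<m. v ! k) = (\<Sum>k<m. u ! k)"
    using v assms unfolding sum_remove_two[OF assms(2-4)]
    by (auto simp: line_def intro!: sum.cong)
  then show "v \<in> SR_vertices m n"
    using v assms by (auto simp: SR_vertices_def line_def sum_list_sum_nth atLeast0LessThan)
qed

lemma line_eq_image:
  assumes "length v = m" "i < m" "j < m" "i \<noteq> j"
  shows "line m i j v = (\<lambda>x. v[i := x, j := v ! i + v ! j - x]) ` {..v ! i + v ! j}"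
proof (intro equalityI subsetI)
  fix u assume u: "u \<in> line m i j v"
  have "u = v[i := u ! i, j := v ! i + v ! j - u ! i]"
  proof (rule nth_equalityI)
    fix k assume "k < length u"
    then show "u ! k = v[i := u ! i, j := v ! i + v ! j - u ! i] ! k"
      using u assms by (cases "k = i"; cases "k = j") (auto simp: line_def)
  qed (use u assms in \<open>auto simp: line_def\<close>)
  moreover have "u ! i \<le> v ! i + v ! j" using u by (auto simp: line_def)
  ultimately show "u \<in> (\<lambda>x. v[i := x, j := v ! i + v ! j - x]) ` {..v ! i + v ! j}"
    by blast
qed (use assms in \<open>auto simp: line_def\<close>)

lemma card_line:
  assumes "length v = m" "i < m" "j < m" "i \<noteq> j"
  shows "card (line m i j v) = v ! i + v ! j + 1"
proof -
  have "inj_on (\<lambda>x. v[i := x, j := v ! i + v ! j - x]) {..v ! i + v ! j}"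
  proof (rule inj_onI)
    fix x y assume "v[i := x, j := v ! i + v ! j - x] = v[i := y, j := v ! i + v ! j - y]"
    from arg_cong[OF this, of "\<lambda>l. l ! i"] show "x = y" using assms by simp
  qed
  then show ?thesis unfolding line_eq_image[OF assms] by (simp add: card_image)
qed

lemma line_eqI:
  assumes "u \<in> line m i j v" "u' \<in> line m i j v" "u ! i = u' ! i"
  shows "u = u'"
proof (rule nth_equalityI)
  fix k assume "k < length u"
  then show "u ! k = u' ! k"
    using assms by (cases "k = i"; cases "k = j") (auto simp: line_def)
qed (use assms in \<open>auto simp: line_def\<close>)

section \<open>Block sums and unions of classes\<close>

text \<open>Only the entries \<open>i\<close> and \<open>j\<close> change along the line. The
  additive form avoids truncated subtraction and serves both when \<open>i\<close> and
  \<open>j\<close> share a block and when they do not.\<close>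

lemma block_sum_line:
  assumes "u \<in> line m i j v" "i < m" "j < m" "i \<noteq> j"
  shows "block_sum m \<phi> u r + (if \<phi> i = r then v ! i else 0) + (if \<phi> j = r then v ! j else 0)
    = block_sum m \<phi> v r + (if \<phi> i = r then u ! i else 0) + (if \<phi> j = r then u ! j else 0)"
proof -
  have "(\<Sum>k\<in>{..<m} - {i} - {j}. if \<phi> k = r then u ! k else 0)
      = (\<Sum>k\<in>{..<m} - {i} - {j}. if \<phi> k = r then v ! k else 0)"
    using assms by (intro sum.cong) (auto simp: line_def)
  then show ?thesis unfolding block_sum_def sum_remove_two[OF assms(2-4)] by simp
qed

lemma block_sum_fun_upd:
  assumes "j < m"
  shows "block_sum m (\<phi>(j := p)) v r + (if \<phi> j = r then v ! j else 0)
    = block_sum m \<phi> v r + (if p = r then v ! j else 0)"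
proof -
  have *: "block_sum m \<psi> v r = (if \<psi> j = r then v ! j else 0)
      + (\<Sum>k\<in>{..<m} - {j}. if \<psi> k = r then v ! k else 0)" for \<psi>
    unfolding block_sum_def by (rule sum.remove) (use assms in auto)
  have "(\<Sum>k\<in>{..<m} - {j}. if (\<phi>(j := p)) k = r then v ! k else 0)
      = (\<Sum>k\<in>{..<m} - {j}. if \<phi> k = r then v ! k else 0)"
    by (rule sum.cong) auto
  then show ?thesis unfolding *[of "\<phi>(j := p)"] *[of \<phi>] by simp
qed

text \<open>Grouping coordinates by block shows that a linear form whose coefficients are constant
  on blocks depends only on the block sums. Both the weight and the same-block count are class
  invariants for this reason.\<close>

lemma sum_mult_block_sum:
  fixes g :: "nat \<Rightarrow> nat"
  shows "(\<Sum>i<m. g (\<phi> i) * a ! i) = (\<Sum>r\<in>\<phi> ` {..<m}. g r * block_sum m \<phi> a r)"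
proof -
  have "(\<Sum>r\<in>\<phi> ` {..<m}. g r * block_sum m \<phi> a r)
     = (\<Sum>r\<in>\<phi> ` {..<m}. \<Sum>i<m. if \<phi> i = r then g r * a ! i else 0)"
    unfolding block_sum_def sum_distrib_left by (intro sum.cong) auto
  also have "\<dots> = (\<Sum>i<m. \<Sum>r\<in>\<phi> ` {..<m}. if \<phi> i = r then g r * a ! i else 0)"
    by (rule sum.swap)
  also have "\<dots> = (\<Sum>i<m. g (\<phi> i) * a ! i)"
    by (intro sum.cong) (auto simp: sum.delta)
  finally show ?thesis ..
qed

text \<open>A condition on block sums alone cuts out a disjoint union of classes, and
  \<open>f\<close> sums to zero over each of them.\<close>

lemma sum_block_saturated_eq_0:
  fixes f :: "nat list \<Rightarrow> complex"
  assumes "\<And>a. a \<in> SR_vertices m n \<Longrightarrow> Q (block_sum m \<phi> a) \<Longrightarrow> sum f (block_class m n \<phi> a) = 0"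
  shows "sum f {a \<in> SR_vertices m n. Q (block_sum m \<phi> a)} = 0"
proof -
  let ?T = "{a \<in> SR_vertices m n. Q (block_sum m \<phi> a)}"
  have fin: "finite ?T" by (simp add: finite_SR_vertices)
  have "sum f ?T = (\<Sum>k\<in>block_sum m \<phi> ` ?T. sum f {b \<in> ?T. block_sum m \<phi> b = k})"
    by (rule sum.group[symmetric]) (use fin in auto)
  also have "\<dots> = (\<Sum>k\<in>block_sum m \<phi> ` ?T. 0)"
  proof (rule sum.cong)
    fix k assume "k \<in> block_sum m \<phi> ` ?T"
    then obtain a where a: "a \<in> ?T" "k = block_sum m \<phi> a" by auto
    then have "{b \<in> ?T. block_sum m \<phi> b = k} = block_class m n \<phi> a"
      by (auto simp: block_class_def)
    then show "sum f {b \<in> ?T. block_sum m \<phi> b = k} = 0" using assms a by simp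
  qed simp
  finally show ?thesis by simp
qed

section \<open>Neighbourhoods as unions of lines\<close>

text \<open>Equal coordinate sums force the two differing entries to have the same total in
  \<open>u\<close> and \<open>v\<close>. Conversely, on a line a change in one of the two entries
  forces a change in the other.\<close>

lemma SR_adj_eq_Union_lines:
  assumes u: "u \<in> SR_vertices m n"
  shows "{v \<in> SR_vertices m n. SR_adj m u v} = (\<Union>(i, j)\<in>pairs m. line m i j u - {u})"
proof (intro equalityI subsetI)
  fix v assume "v \<in> {v \<in> SR_vertices m n. SR_adj m u v}"
  then have v: "v \<in> SR_vertices m n" and c: "card {i. i < m \<and> u ! i \<noteq> v ! i} = 2"
    by (auto simp: SR_adj_def)
  from c obtain x y where xy: "{i. i < m \<and> u ! i \<noteq> v ! i} = {x, y}" "x \<noteq> y"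
    unfolding card_2_iff by blast
  obtain i j where ij: "{i. i < m \<and> u ! i \<noteq> v ! i} = {i, j}" "i < j"
  proof (cases "x < y")
    case True
    then show ?thesis using that xy by blast
  next
    case False
    then have "y < x" using xy by simp
    then show ?thesis using that[of y x] xy by (simp add: insert_commute)
  qed
  have diff: "k < m \<and> u ! k \<noteq> v ! k \<longleftrightarrow> k = i \<or> k = j" for k
    using eqset_imp_iff[OF ij(1), of k] by simp
  have m: "i < m" "j < m" "u ! i \<noteq> v ! i" using diff[of i] diff[of j] by simp_all
  have eq: "v ! k = u ! k" if "k < m" "k \<noteq> i" "k \<noteq> j" for k
    using diff[of k] that by simp
  have "(\<Sum>k<m. v ! k) = (\<Sum>k<m. u ! k)"
    using u v by (auto simp: SR_vertices_def sum_list_sum_nth atLeast0LessThan)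
  moreover have "(\<Sum>k\<in>{..<m} - {i} - {j}. v ! k) = (\<Sum>k\<in>{..<m} - {i} - {j}. u ! k)"
    by (rule sum.cong) (auto simp: eq)
  ultimately have "v ! i + v ! j = u ! i + u ! j"
    using ij(2) m sum_remove_two[of i m j "\<lambda>k. v ! k"] sum_remove_two[of i m j "\<lambda>k. u ! k"] by simp
  then have "v \<in> line m i j u - {u}" using eq v m by (auto simp: line_def SR_vertices_def)
  then show "v \<in> (\<Union>(i, j)\<in>pairs m. line m i j u - {u})" using ij m by (auto simp: pairs_def)
next
  fix v assume "v \<in> (\<Union>(i, j)\<in>pairs m. line m i j u - {u})"
  then obtain i j where ij: "i < j" "j < m" and v: "v \<in> line m i j u" "v \<noteq> u"
    by (auto simp: pairs_def)
  have ul: "u \<in> line m i j u" using u by (auto simp: line_def SR_vertices_def)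
  have "v ! i \<noteq> u ! i" using line_eqI[OF v(1) ul] v(2) by blast
  moreover have "v ! j \<noteq> u ! j" using calculation v by (auto simp: line_def)
  ultimately have "{k. k < m \<and> u ! k \<noteq> v ! k} = {i, j}"
    using v ij by (fastforce simp: line_def)
  then show "v \<in> {v \<in> SR_vertices m n. SR_adj m u v}"
    using ij v(1) line_subset_SR_vertices[OF u, of i j] by (auto simp: SR_adj_def)
qed

text \<open>A point \<open>v\<close> other than \<open>u\<close> on the line differs from
  \<open>u\<close> exactly at \<open>i\<close> and \<open>j\<close>, so it determines the ordered
  pair \<open>i < j\<close>.\<close>

lemma lines_disjoint:
  assumes "length u = m" "(i, j) \<in> pairs m" "(i', j') \<in> pairs m" "(i, j) \<noteq> (i', j')"
  shows "(line m i j u - {u}) \<inter> (line m i' j' u - {u}) = {}"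
proof (rule ccontr)
  assume "\<not> ?thesis"
  then obtain v where v: "v \<in> line m i j u" "v \<in> line m i' j' u" "v \<noteq> u" by blast
  have ul: "u \<in> line m i j u" "u \<in> line m i' j' u" using assms by (auto simp: line_def)
  have "v ! i \<noteq> u ! i" "v ! i' \<noteq> u ! i'"
    using line_eqI[OF v(1) ul(1)] line_eqI[OF v(2) ul(2)] v(3) by blast+
  moreover from this have "v ! j \<noteq> u ! j" "v ! j' \<noteq> u ! j'"
    using v by (auto simp: line_def)
  moreover have "i < j" "j < m" "i' < j'" "j' < m" using assms by (auto simp: pairs_def)
  moreover have "v ! k = u ! k" if "k < m" "k \<noteq> i \<and> k \<noteq> j \<or> k \<noteq> i' \<and> k \<noteq> j'" for k
    using v that by (auto simp: line_def)
  ultimately have "i = i' \<and> j = j'"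
    by (metis less_asym less_trans)
  then show False using assms(4) by simp
qed

lemma sum_neighbours:
  fixes f :: "nat list \<Rightarrow> complex"
  assumes u: "u \<in> SR_vertices m n"
  shows "sum f {v \<in> SR_vertices m n. SR_adj m u v} = (\<Sum>(i, j)\<in>pairs m. sum f (line m i j u) - f u)"
proof -
  have len: "length u = m" using u by (simp add: SR_vertices_def)
  have fin: "finite (line m i j u)" if "(i, j) \<in> pairs m" for i j
    using that line_subset_SR_vertices[OF u, of i j] finite_SR_vertices
    by (auto simp: pairs_def intro: finite_subset)
  have "sum f {v \<in> SR_vertices m n. SR_adj m u v}
      = (\<Sum>x\<in>pairs m. sum f (case x of (i, j) \<Rightarrow> line m i j u - {u}))"
    unfolding SR_adj_eq_Union_lines[OF u]
  proof (rule sum.UNION_disjoint)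
    show "\<forall>x\<in>pairs m. \<forall>y\<in>pairs m. x \<noteq> y \<longrightarrow>
      (case x of (i, j) \<Rightarrow> line m i j u - {u}) \<inter> (case y of (i, j) \<Rightarrow> line m i j u - {u}) = {}"
      using lines_disjoint[OF len] by fast
  qed (use finite_pairs fin in auto)
  also have "\<dots> = (\<Sum>(i, j)\<in>pairs m. sum f (line m i j u) - f u)"
  proof (rule sum.cong, rule refl, clarify)
    fix i j assume ij: "(i, j) \<in> pairs m"
    have "u \<in> line m i j u" using len by (simp add: line_def)
    then show "sum f (line m i j u - {u}) = sum f (line m i j u) - f u"
      using fin[OF ij] by (simp add: sum_diff1)
  qed
  finally show ?thesis .
qed

section \<open>Line sums added up over a class\<close>

text \<open>Double counting: \<open>f v\<close> occurs once for each \<open>u\<close> in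
  \<open>C\<close> whose line contains \<open>v\<close>, and by symmetry these are the
  \<open>u\<close> in \<open>C\<close> on the line through \<open>v\<close>.\<close>

lemma sum_class_lines:
  fixes f :: "nat list \<Rightarrow> complex"
  assumes "C \<subseteq> SR_vertices m n" "i < m" "j < m" "i \<noteq> j"
  shows "(\<Sum>u\<in>C. sum f (line m i j u))
    = (\<Sum>v\<in>SR_vertices m n. of_nat (card (C \<inter> line m i j v)) * f v)"
proof -
  let ?V = "SR_vertices m n"
  have finC: "finite C" using assms finite_SR_vertices finite_subset by blast
  have "(\<Sum>u\<in>C. sum f (line m i j u)) = (\<Sum>u\<in>C. \<Sum>v\<in>?V. if v \<in> line m i j u then f v else 0)"
  proof (rule sum.cong)
    fix u assume "u \<in> C"
    then have "{v \<in> ?V. v \<in> line m i j u} = line m i j u"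
      using line_subset_SR_vertices assms by blast
    then show "sum f (line m i j u) = (\<Sum>v\<in>?V. if v \<in> line m i j u then f v else 0)"
      using sum.inter_filter[OF finite_SR_vertices[of m n], of f "\<lambda>v. v \<in> line m i j u"] by simp
  qed simp
  also have "\<dots> = (\<Sum>v\<in>?V. \<Sum>u\<in>C. if v \<in> line m i j u then f v else 0)" by (rule sum.swap)
  also have "\<dots> = (\<Sum>v\<in>?V. of_nat (card (C \<inter> line m i j v)) * f v)"
  proof (rule sum.cong)
    fix v assume v: "v \<in> ?V"
    have "C \<inter> line m i j v = {u \<in> C. v \<in> line m i j u}"
    proof -
      have "u \<in> line m i j v \<longleftrightarrow> v \<in> line m i j u" if "u \<in> C" for u
        by (rule line_sym) (use that v assms(1) in \<open>auto simp: SR_vertices_def\<close>)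
      then show ?thesis by blast
    qed
    then show "(\<Sum>u\<in>C. if v \<in> line m i j u then f v else 0) = of_nat (card (C \<inter> line m i j v)) * f v"
      using finC by (simp flip: sum.inter_filter)
  qed simp
  finally show ?thesis .
qed

text \<open>Moving along a line inside one block preserves all block sums, so the line through
  \<open>v\<close> lies wholly in the class or misses it.\<close>

lemma sum_class_lines_same_block:
  fixes f :: "nat list \<Rightarrow> complex" and n :: nat and a :: "nat list"
  assumes ij: "i < m" "j < m" "i \<noteq> j" and eq: "\<phi> i = \<phi> j"
  defines "C \<equiv> block_class m n \<phi> a"
  shows "(\<Sum>u\<in>C. sum f (line m i j u)) = (\<Sum>v\<in>C. of_nat (v ! i + v ! j + 1) * f v)"
proof -
  let ?V = "SR_vertices m n"
  have C: "C \<subseteq> ?V" by (auto simp: C_def block_class_def)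
  have bs: "block_sum m \<phi> u = block_sum m \<phi> v" if "u \<in> line m i j v" for u v
  proof
    fix r show "block_sum m \<phi> u r = block_sum m \<phi> v r"
      using block_sum_line[OF that ij, of \<phi> r] that eq by (auto simp: line_def split: if_splits)
  qed
  have "(\<Sum>u\<in>C. sum f (line m i j u)) = (\<Sum>v\<in>?V. of_nat (card (C \<inter> line m i j v)) * f v)"
    by (rule sum_class_lines[OF C ij])
  also have "\<dots> = (\<Sum>v\<in>?V. if v \<in> C then of_nat (v ! i + v ! j + 1) * f v else 0)"
  proof (rule sum.cong)
    fix v assume v: "v \<in> ?V"
    have "C \<inter> line m i j v = (if v \<in> C then line m i j v else {})"
      using bs[of _ v] v line_subset_SR_vertices[OF v ij] by (auto simp: C_def block_class_def)
    moreover have "card (line m i j v) = v ! i + v ! j + 1"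
      using card_line ij v by (simp add: SR_vertices_def)
    ultimately show "of_nat (card (C \<inter> line m i j v)) * f v
      = (if v \<in> C then of_nat (v ! i + v ! j + 1) * f v else 0)" by simp
  qed simp
  also have "\<dots> = (\<Sum>v\<in>{v \<in> ?V. v \<in> C}. of_nat (v ! i + v ! j + 1) * f v)"
    by (rule sum.inter_filter[symmetric]) (rule finite_SR_vertices)
  also have "{v \<in> ?V. v \<in> C} = C" using C by blast
  finally show ?thesis .
qed

section \<open>Weights and lines across two blocks\<close>

text \<open>Apart from a constant depending only on \<open>\<phi>\<close>, the weight is twice the
  sum of label times block sum. Only the terms for \<open>p\<close> and \<open>q\<close> can change,
  and their block sums have a fixed total.\<close>

lemma weight_diff:
  assumes "p \<in> \<phi> ` {..<m}" "q \<in> \<phi> ` {..<m}" "p \<noteq> q"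
    and "\<And>r. r \<noteq> p \<Longrightarrow> r \<noteq> q \<Longrightarrow> block_sum m \<phi> v r = block_sum m \<phi> a r"
    and "block_sum m \<phi> v p + block_sum m \<phi> v q = block_sum m \<phi> a p + block_sum m \<phi> a q"
  shows "int (weight m \<phi> v) = int (weight m \<phi> a)
    - 2 * (int q - int p) * (int (block_sum m \<phi> v p) - int (block_sum m \<phi> a p))"
proof -
  let ?I = "\<phi> ` {..<m}"
  have w: "weight m \<phi> b = 2 * (\<Sum>r\<in>?I. r * block_sum m \<phi> b r) + (\<Sum>i<m. \<phi> i)" for b
    using sum_mult_block_sum[of "\<lambda>r. r" \<phi> b m]
    by (simp add: weight_def distrib_left sum.distrib mult.left_commute[of _ 2] flip: sum_distrib_left)
  have s: "(\<Sum>r\<in>?I. r * block_sum m \<phi> b r) = p * block_sum m \<phi> b p + (q * block_sum m \<phi> b q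
      + (\<Sum>r\<in>?I - {p} - {q}. r * block_sum m \<phi> b r))" for b
    using assms(1-3) by (simp add: sum.remove[of ?I p] sum.remove[of "?I - {p}" q])
  have e: "(\<Sum>r\<in>?I - {p} - {q}. r * block_sum m \<phi> v r) = (\<Sum>r\<in>?I - {p} - {q}. r * block_sum m \<phi> a r)"
    by (rule sum.cong) (use assms(4) in auto)
  have q: "int (block_sum m \<phi> v q) = int (block_sum m \<phi> a p) + int (block_sum m \<phi> a q) - int (block_sum m \<phi> v p)"
    using assms(5) by linarith
  show ?thesis unfolding w s e of_nat_add of_nat_mult q by (simp add: algebra_simps)
qed

lemma weight_fun_upd:
  assumes "j < m"
  shows "int (weight m (\<phi>(j := p)) v) = int (weight m \<phi> v) + (int p - int (\<phi> j)) * (2 * int (v ! j) + 1)"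
proof -
  have *: "weight m \<psi> v = \<psi> j * (2 * v ! j + 1) + (\<Sum>k\<in>{..<m} - {j}. \<psi> k * (2 * v ! k + 1))" for \<psi>
    unfolding weight_def by (rule sum.remove) (use assms in auto)
  have "(\<Sum>k\<in>{..<m} - {j}. (\<phi>(j := p)) k * (2 * v ! k + 1)) = (\<Sum>k\<in>{..<m} - {j}. \<phi> k * (2 * v ! k + 1))"
    by (rule sum.cong) auto
  then show ?thesis unfolding *[of "\<phi>(j := p)"] *[of \<phi>] by (simp add: algebra_simps)
qed

text \<open>The sum of block \<open>p\<close> forces the entry \<open>u ! i\<close> of any class
  member \<open>u\<close> on the line through \<open>v\<close>. So each \<open>v\<close> is counted
  at most once, and exactly when the forced value lies between 0 and
  \<open>v ! i + v ! j\<close>.\<close>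

lemma sum_class_lines_cross_blocks:
  fixes f :: "nat list \<Rightarrow> complex"
  assumes ij: "i < m" "j < m" and less: "\<phi> i < \<phi> j" and a: "a \<in> SR_vertices m n"
    and min: "\<And>\<psi> b. b \<in> SR_vertices m n \<Longrightarrow> weight m \<psi> b < weight m \<phi> a
      \<Longrightarrow> sum f (block_class m n \<psi> b) = 0"
  shows "(\<Sum>u\<in>block_class m n \<phi> a. sum f (line m i j u)) = 0"
proof -
  define p q where "p = \<phi> i" and "q = \<phi> j"
  have pq: "p < q" "\<phi> i = p" "\<phi> j = q" using less by (auto simp: p_def q_def)
  have ne: "i \<noteq> j" using less by auto
  let ?V = "SR_vertices m n" and ?C = "block_class m n \<phi> a" and ?s = "block_sum m \<phi> a"
  \<comment> \<open>\<open>M\<close> collects what a move between blocks \<open>p\<close> and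
    \<open>q\<close> cannot change.\<close>
  define M where "M s \<longleftrightarrow> (\<forall>r. r \<noteq> p \<longrightarrow> r \<noteq> q \<longrightarrow> s r = ?s r) \<and> s p + s q = ?s p + ?s q"
    for s :: "nat \<Rightarrow> nat"
  define \<phi>1 \<phi>2 where "\<phi>1 = \<phi>(j := p)" and "\<phi>2 = \<phi>(i := q)"
  \<comment> \<open>With \<open>x\<close> the forced entry, \<open>x \<le> v ! i + v ! j\<close>
    says that block \<open>p\<close> enlarged by \<open>j\<close> has sum at least
    \<open>?s p\<close>. The bound \<open>0 \<le> x\<close> fails exactly when block
    \<open>p\<close> without \<open>i\<close> already exceeds \<open>?s p\<close>.\<close>
  define T1 T2 where "T1 = {v \<in> ?V. M (block_sum m \<phi>1 v) \<and> ?s p \<le> block_sum m \<phi>1 v p}"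
    and "T2 = {v \<in> ?V. M (block_sum m \<phi>2 v) \<and> ?s p < block_sum m \<phi>2 v p}"
  have s1: "block_sum m \<phi>1 v p = block_sum m \<phi> v p + v ! j"
    "block_sum m \<phi>1 v q + v ! j = block_sum m \<phi> v q"
    "r \<noteq> p \<Longrightarrow> r \<noteq> q \<Longrightarrow> block_sum m \<phi>1 v r = block_sum m \<phi> v r" for v r
    using block_sum_fun_upd[OF ij(2), of \<phi> p v p] block_sum_fun_upd[OF ij(2), of \<phi> p v q]
      block_sum_fun_upd[OF ij(2), of \<phi> p v r] pq by (simp_all add: \<phi>1_def)
  have s2: "block_sum m \<phi>2 v p + v ! i = block_sum m \<phi> v p"
    "block_sum m \<phi>2 v q = block_sum m \<phi> v q + v ! i"
    "r \<noteq> p \<Longrightarrow> r \<noteq> q \<Longrightarrow> block_sum m \<phi>2 v r = block_sum m \<phi> v r" for v r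
    using block_sum_fun_upd[OF ij(1), of \<phi> q v p] block_sum_fun_upd[OF ij(1), of \<phi> q v q]
      block_sum_fun_upd[OF ij(1), of \<phi> q v r] pq by (simp_all add: \<phi>2_def)
  have M1: "M (block_sum m \<phi>1 v) \<longleftrightarrow> M (block_sum m \<phi> v)" for v
    using s1(1,2)[of v] s1(3)[of _ v] by (auto simp: M_def)
  have M2: "M (block_sum m \<phi>2 v) \<longleftrightarrow> M (block_sum m \<phi> v)" for v
    using s2(1,2)[of v] s2(3)[of _ v] by (auto simp: M_def)
  have w: "int (weight m \<phi> v) = int (weight m \<phi> a)
      - 2 * (int q - int p) * (int (block_sum m \<phi> v p) - int (?s p))" if "M (block_sum m \<phi> v)" for v
    using weight_diff[of p \<phi> m q v a] ij pq that by (auto simp: M_def)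
  have T1: "sum f T1 = 0" unfolding T1_def
  proof (rule sum_block_saturated_eq_0, erule conjE)
    fix v assume v: "v \<in> ?V" "M (block_sum m \<phi>1 v)" "?s p \<le> block_sum m \<phi>1 v p"
    have "int (weight m \<phi>1 v) = int (weight m \<phi> a)
        - (int q - int p) * (2 * (int (block_sum m \<phi>1 v p) - int (?s p)) + 1)"
      using w[of v] v(2) M1 weight_fun_upd[OF ij(2), of \<phi> p v] pq s1(1)[of v]
      by (simp add: \<phi>1_def algebra_simps)
    \<comment> \<open>The summand 1, gained by relabelling \<open>j\<close> itself, keeps this
      positive when the block sum equals \<open>?s p\<close>.\<close>
    moreover have "0 < (int q - int p) * (2 * (int (block_sum m \<phi>1 v p) - int (?s p)) + 1)"
      by (rule mult_pos_pos) (use pq v in auto)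
    ultimately show "sum f (block_class m n \<phi>1 v) = 0" using min[OF v(1)] by simp
  qed
  have T2: "sum f T2 = 0" unfolding T2_def
  proof (rule sum_block_saturated_eq_0, erule conjE)
    fix v assume v: "v \<in> ?V" "M (block_sum m \<phi>2 v)" "?s p < block_sum m \<phi>2 v p"
    have "int (weight m \<phi>2 v) = int (weight m \<phi> a)
        - (int q - int p) * (2 * (int (block_sum m \<phi>2 v p) - int (?s p)) - 1)"
      using w[of v] v(2) M2 weight_fun_upd[OF ij(1), of \<phi> q v] pq s2(1)[of v, symmetric]
      by (simp add: \<phi>2_def algebra_simps)
    \<comment> \<open>The strict inequality in \<open>T2\<close> makes the doubled difference at
      least 2, which outweighs the 1 lost by relabelling \<open>i\<close>.\<close>
    moreover have "0 < (int q - int p) * (2 * (int (block_sum m \<phi>2 v p) - int (?s p)) - 1)"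
      by (rule mult_pos_pos) (use pq v in auto)
    ultimately show "sum f (block_class m n \<phi>2 v) = 0" using min[OF v(1)] by simp
  qed
  have T21: "T2 \<subseteq> T1"
  proof
    fix v assume "v \<in> T2"
    then show "v \<in> T1" using s1(1)[of v] s2(1)[of v] by (auto simp: T1_def T2_def M1 M2)
  qed
  have line: "block_sum m \<phi> u p + v ! i = block_sum m \<phi> v p + u ! i"
    "block_sum m \<phi> u q + v ! j = block_sum m \<phi> v q + u ! j"
    "r \<noteq> p \<Longrightarrow> r \<noteq> q \<Longrightarrow> block_sum m \<phi> u r = block_sum m \<phi> v r"
    "u ! i + u ! j = v ! i + v ! j"
    if "u \<in> line m i j v" for u v r
    using block_sum_line[OF that ij ne, of \<phi> p] block_sum_line[OF that ij ne, of \<phi> q]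
      block_sum_line[OF that ij ne, of \<phi> r] pq that by (auto simp: line_def)
  have card: "card (?C \<inter> line m i j v) = (if v \<in> T1 - T2 then 1 else 0)" if v: "v \<in> ?V" for v
  proof (cases "v \<in> T1 - T2")
    case True
    have Mv: "M (block_sum m \<phi> v)" and b: "?s p \<le> block_sum m \<phi> v p + v ! j"
      "block_sum m \<phi> v p \<le> ?s p + v ! i"
      using True s1(1)[of v] s2(1)[of v] by (auto simp: T1_def T2_def M1 M2)
    \<comment> \<open>Solving for the entry at \<open>i\<close> that makes the sum of block
      \<open>p\<close> equal to \<open>?s p\<close>; the second bound in \<open>b\<close> makes the
      subtraction exact.\<close>
    define x where "x = ?s p + v ! i - block_sum m \<phi> v p"
    define u where "u = v[i := x, j := v ! i + v ! j - x]"
    have x: "x \<le> v ! i + v ! j" using b unfolding x_def by simp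
    have u: "u \<in> line m i j v" "u ! i = x"
      using x v ij ne by (auto simp: u_def line_def SR_vertices_def)
    have "block_sum m \<phi> u = ?s"
    proof
      fix r show "block_sum m \<phi> u r = ?s r"
        using line[OF u(1)] Mv b u(2) by (cases "r = p"; cases "r = q") (auto simp: x_def M_def)
    qed
    then have uC: "u \<in> ?C" using line_subset_SR_vertices[OF v ij ne] u by (auto simp: block_class_def)
    have "?C \<inter> line m i j v = {u}"
    proof (intro equalityI subsetI)
      fix u' assume u': "u' \<in> ?C \<inter> line m i j v"
      then have "u' ! i = u ! i"
        using line(1)[of u' v] line(1)[OF u(1)] uC by (auto simp: block_class_def)
      then show "u' \<in> {u}" using line_eqI[of u' m i j v u] u' u by auto
    qed (use u uC in auto)
    then show ?thesis using True by simp
  next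
    case False
    \<comment> \<open>Conversely, nonnegativity of \<open>u ! i\<close> and \<open>u ! j\<close> for
      a class member \<open>u\<close> on the line yields both bounds for \<open>v\<close>.\<close>
    have "u \<notin> ?C" if u: "u \<in> line m i j v" for u
    proof
      assume "u \<in> ?C"
      then have e: "block_sum m \<phi> u = ?s" by (simp add: block_class_def)
      have "M (block_sum m \<phi> v)" using line[OF u] e by (auto simp: M_def)
      then have "v \<in> T1 - T2"
        using v line[OF u] s1(1)[of v] s2(1)[of v] e by (auto simp: T1_def T2_def M1 M2)
      then show False using False by blast
    qed
    then have "?C \<inter> line m i j v = {}" by blast
    then show ?thesis using False by simp
  qed
  have "(\<Sum>u\<in>?C. sum f (line m i j u)) = (\<Sum>v\<in>?V. of_nat (card (?C \<inter> line m i j v)) * f v)"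
    by (rule sum_class_lines) (use ij ne in \<open>auto simp: block_class_def\<close>)
  also have "\<dots> = (\<Sum>v\<in>?V. if v \<in> T1 - T2 then f v else 0)"
    by (rule sum.cong) (auto simp: card)
  also have "\<dots> = sum f {v \<in> ?V. v \<in> T1 - T2}"
    by (rule sum.inter_filter[symmetric]) (rule finite_SR_vertices)
  also have "{v \<in> ?V. v \<in> T1 - T2} = T1 - T2" by (auto simp: T1_def)
  also have "sum f (T1 - T2) = sum f T1 - sum f T2"
    by (rule sum_diff) (use T21 finite_SR_vertices in \<open>auto simp: T1_def\<close>)
  finally show ?thesis using T1 T2 by simp
qed

section \<open>Invariance of the same-block count\<close>

text \<open>Over all ordered pairs, diagonal included, each row sum involves only block sizes, block
  sums and a multiple of \<open>a ! i\<close> that is constant on blocks. The total is thus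
  invariant, and so is the diagonal part; subtracting it and halving leaves the pairs
  \<open>i < j\<close>.\<close>

lemma same_block_pairs_sum_cong:
  assumes "block_sum m \<phi> a = block_sum m \<phi> b"
  shows "(\<Sum>(i, j)\<in>pairs m. if \<phi> i = \<phi> j then a ! i + a ! j + 1 else 0)
       = (\<Sum>(i, j)\<in>pairs m. if \<phi> i = \<phi> j then b ! i + b ! j + 1 else (0::nat))"
proof -
  define c where "c a i j = (if \<phi> i = \<phi> j then a ! i + a ! j + 1 else (0::nat))" for a i j
  define s where "s r = card {i. i < m \<and> \<phi> i = r}" for r
  have split: "(\<Sum>i<m. \<Sum>j<m. c a i j) = 2 * (\<Sum>(i, j)\<in>pairs m. c a i j) + (\<Sum>i<m. c a i i)" for a
  proof -
    have "(\<Sum>i<m. \<Sum>j<m. c a i j) = (\<Sum>(i, j)\<in>{..<m} \<times> {..<m}. c a i j)"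
      by (simp add: sum.cartesian_product)
    also have "{..<m} \<times> {..<m} = (pairs m \<union> prod.swap ` pairs m) \<union> (\<lambda>i. (i, i)) ` {..<m}"
      by (auto simp: pairs_def image_iff)
    also have "(\<Sum>(i, j)\<in>\<dots>. c a i j) = (\<Sum>(i, j)\<in>pairs m. c a i j)
        + (\<Sum>(i, j)\<in>prod.swap ` pairs m. c a i j) + (\<Sum>(i, j)\<in>(\<lambda>i. (i, i)) ` {..<m}. c a i j)"
      using finite_pairs[of m] by (subst sum.union_disjoint, (auto simp: pairs_def)[3])+ simp
    also have "(\<Sum>(i, j)\<in>prod.swap ` pairs m. c a i j) = (\<Sum>(i, j)\<in>pairs m. c a i j)"
      by (subst sum.reindex) (auto simp: c_def intro!: sum.cong)
    also have "(\<Sum>(i, j)\<in>(\<lambda>i. (i, i)) ` {..<m}. c a i j) = (\<Sum>i<m. c a i i)"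
      by (subst sum.reindex) (auto simp: inj_on_def)
    finally show ?thesis by simp
  qed
  have row: "(\<Sum>j<m. c a i j) = s (\<phi> i) * a ! i + block_sum m \<phi> a (\<phi> i) + s (\<phi> i)" for a i
  proof -
    have "(\<Sum>j<m. c a i j) = (\<Sum>j<m. (if \<phi> j = \<phi> i then a ! i else 0)
        + (if \<phi> j = \<phi> i then a ! j else 0) + (if \<phi> j = \<phi> i then 1 else 0))"
      by (rule sum.cong) (auto simp: c_def)
    also have "\<dots> = s (\<phi> i) * a ! i + block_sum m \<phi> a (\<phi> i) + s (\<phi> i)"
      by (simp add: sum.distrib block_sum_def s_def flip: sum.inter_filter)
    finally show ?thesis .
  qed
  have lin: "(\<Sum>i<m. g (\<phi> i) * a ! i) = (\<Sum>i<m. g (\<phi> i) * b ! i)" for g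
    using assms by (simp add: sum_mult_block_sum)
  have "(\<Sum>i<m. \<Sum>j<m. c a i j) = (\<Sum>i<m. \<Sum>j<m. c b i j)"
    using lin[of s] assms by (simp add: row sum.distrib)
  \<comment> \<open>The diagonal terms are \<open>2 * a ! i + 1\<close>, a linear form with constant
    coefficient 2 plus a constant.\<close>
  moreover have "(\<Sum>i<m. c a i i) = (\<Sum>i<m. c b i i)"
    using lin[of "\<lambda>_. 2"] by (simp add: c_def mult_2[symmetric] sum_Suc)
  ultimately have "(\<Sum>(i, j)\<in>pairs m. c a i j) = (\<Sum>(i, j)\<in>pairs m. c b i j)"
    using split[of a] split[of b] by simp
  then show ?thesis by (simp add: c_def)
qed

section \<open>Integrality of the eigenvalue\<close>

lemma SR_eigenfunction_Ints:
  fixes f :: "nat list \<Rightarrow> complex"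
  assumes eig: "\<And>u. u \<in> SR_vertices m n \<Longrightarrow> sum f {v \<in> SR_vertices m n. SR_adj m u v} = k * f u"
    and nz: "u0 \<in> SR_vertices m n" "f u0 \<noteq> 0"
  shows "k \<in> \<int>"
proof -
  let ?V = "SR_vertices m n"
  let ?P = "\<lambda>(\<phi>, a). a \<in> ?V \<and> sum f (block_class m n \<phi> a) \<noteq> 0"
  \<comment> \<open>With every coordinate in its own block the classes are singletons, so some class
    has nonzero sum and a minimal one can be chosen.\<close>
  have "block_class m n id u0 = {u0}"
  proof (intro equalityI subsetI)
    fix b assume b: "b \<in> block_class m n id u0"
    have "block_sum m id c k = c ! k" if "k < m" for c k
      using that by (simp add: block_sum_def)
    then have "b ! k = u0 ! k" if "k < m" for k
      using b that unfolding block_class_def by (metis (mono_tags, lifting) mem_Collect_eq)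
    then show "b \<in> {u0}"
      using b nz by (auto simp: block_class_def SR_vertices_def intro!: nth_equalityI)
  qed (use nz in \<open>auto simp: block_class_def\<close>)
  then have "?P (id, u0)" using nz by simp
  then obtain \<phi> a where a: "a \<in> ?V" "sum f (block_class m n \<phi> a) \<noteq> 0"
    and min: "\<And>\<psi> b. ?P (\<psi>, b) \<Longrightarrow> weight m \<phi> a \<le> weight m \<psi> b"
    using ex_has_least_nat[of ?P "(id, u0)" "\<lambda>(\<phi>, a). weight m \<phi> a"] by fastforce
  have min': "sum f (block_class m n \<psi> b) = 0" if "b \<in> ?V" "weight m \<psi> b < weight m \<phi> a" for \<psi> b
    using min[of \<psi> b] that by fastforce
  let ?C = "block_class m n \<phi> a"
  define K where "K a = (\<Sum>(i, j)\<in>pairs m. if \<phi> i = \<phi> j then a ! i + a ! j + 1 else (0::nat))" for a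
  have K: "K v = K a" if "v \<in> ?C" for v
    unfolding K_def by (rule same_block_pairs_sum_cong) (use that in \<open>simp add: block_class_def\<close>)
  have "k * sum f ?C = (\<Sum>u\<in>?C. \<Sum>(i, j)\<in>pairs m. sum f (line m i j u) - f u)"
    unfolding sum_distrib_left
    by (rule sum.cong) (auto simp: block_class_def eig simp flip: sum_neighbours)
  also have "\<dots> = (\<Sum>(i, j)\<in>pairs m. (\<Sum>u\<in>?C. sum f (line m i j u)) - sum f ?C)"
    by (subst sum.swap) (simp add: case_prod_unfold sum_subtractf)
  also have "\<dots> = (\<Sum>(i, j)\<in>pairs m. (\<Sum>v\<in>?C. of_nat (if \<phi> i = \<phi> j then v ! i + v ! j + 1 else 0) * f v)
      - sum f ?C)"
  proof (rule sum.cong, rule refl, clarify)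
    fix i j assume "(i, j) \<in> pairs m"
    then have ij: "i < m" "j < m" "i \<noteq> j" by (auto simp: pairs_def)
    \<comment> \<open>The pair is ordered by index, not by block label, so the roles of
      \<open>i\<close> and \<open>j\<close> may have to be exchanged.\<close>
    have "(\<Sum>u\<in>?C. sum f (line m i j u)) = 0" if "\<phi> i \<noteq> \<phi> j"
      using that sum_class_lines_cross_blocks[OF ij(1,2) _ a(1) min']
        sum_class_lines_cross_blocks[OF ij(2,1) _ a(1) min'] line_commute[of m i j]
      by (metis (no_types, lifting) linorder_neqE_nat sum.cong)
    then show "(\<Sum>u\<in>?C. sum f (line m i j u)) - sum f ?C
      = (\<Sum>v\<in>?C. of_nat (if \<phi> i = \<phi> j then v ! i + v ! j + 1 else 0) * f v) - sum f ?C"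
      using sum_class_lines_same_block[OF ij, of \<phi> f n a] by (cases "\<phi> i = \<phi> j") simp_all
  qed
  \<comment> \<open>Exchanging the sums gathers the multiplicities of each \<open>f v\<close> into
    \<open>K v\<close>, which is constant on the class.\<close>
  also have "\<dots> = (\<Sum>v\<in>?C. of_nat (K v) * f v) - of_nat (card (pairs m)) * sum f ?C"
    by (subst K_def) (simp add: case_prod_unfold sum_subtractf sum_distrib_right sum.swap[of _ "pairs m" ?C])
  also have "(\<Sum>v\<in>?C. of_nat (K v) * f v) = of_nat (K a) * sum f ?C"
    by (simp add: K sum_distrib_left)
  finally have "k * sum f ?C = (of_nat (K a) - of_nat (card (pairs m))) * sum f ?C"
    by (simp add: algebra_simps)
  then have "k = of_nat (K a) - of_nat (card (pairs m))" using a by simp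
  then show ?thesis by simp
qed

theorem theorem1:
  fixes m n :: nat and vs :: "nat list list" and k :: complex
  assumes "distinct vs" and "set vs = SR_vertices m n"
    and "eigenvalue (SR_adj_mat m vs) k"
  shows "k \<in> \<int>"
proof -
  let ?A = "SR_adj_mat m vs" and ?N = "length vs" and ?V = "SR_vertices m n"
  obtain x where x: "x \<in> carrier_vec ?N" "x \<noteq> 0\<^sub>v ?N" "?A *\<^sub>v x = k \<cdot>\<^sub>v x"
    using assms(3) by (auto simp: eigenvalue_def eigenvector_def SR_adj_mat_def)
  have bij: "bij_betw (nth vs) {..<?N} ?V" using bij_betw_nth[OF assms(1)] assms(2) by auto
  \<comment> \<open>The eigenvector is transported from indices to vertices by inverting the
    enumeration, which is injective because \<open>vs\<close> is distinct.\<close>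
  define f where "f v = x $ inv_into {..<?N} (nth vs) v" for v
  have f: "f (vs ! i) = x $ i" if "i < ?N" for i
    using that bij by (simp add: f_def bij_betw_def inv_into_f_f)
  obtain i0 where i0: "i0 < ?N" "x $ i0 \<noteq> 0"
    using x(1,2) by (metis carrier_vecD eq_vecI index_zero_vec)
  show ?thesis
  proof (rule SR_eigenfunction_Ints)
    fix u assume "u \<in> ?V"
    then obtain i where i: "i < ?N" "u = vs ! i" using bij by (auto simp: bij_betw_def)
    have "sum f {v \<in> ?V. SR_adj m u v} = (\<Sum>v\<in>?V. if SR_adj m u v then f v else 0)"
      by (rule sum.inter_filter) (rule finite_SR_vertices)
    also have "\<dots> = (\<Sum>j<?N. if SR_adj m u (vs ! j) then f (vs ! j) else 0)"
      by (rule sum.reindex_bij_betw[OF bij, symmetric])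
    also have "\<dots> = (?A *\<^sub>v x) $ i"
      using i x(1) f by (auto simp: SR_adj_mat_def scalar_prod_def atLeast0LessThan intro!: sum.cong)
    also have "\<dots> = k * f u" using x i f by simp
    finally show "sum f {v \<in> ?V. SR_adj m u v} = k * f u" .
  next
    show "vs ! i0 \<in> ?V" using i0(1) bij by (auto simp: bij_betw_def)
    show "f (vs ! i0) \<noteq> 0" using i0 f by simp
  qed
qed

end
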